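(* Let $R$ be a commutative ring with one, let $M$, $N$ and $T$ be $R$-modules, and let $\phi : M \times N \rightarrow T$ be an $R$-bilinear map. Let $\{n_i\}_{i \in I}$ be a set of generators of $N$. Then $T$, with $\phi$, is a tensor product of $M$ and $N$ if the following two conditions hold: (1) every element of $T$ can be written as a finite sum $\sum_i \phi(m_i, n_i)$ with $m_i \in M$ arbitrary; (2) for any family $(m_i)_{i \in I}$ of elements of $M$ with only finitely many $m_i$ nonzero, $\sum_i \phi(m_i, n_i) = 0$ implies the existence of finitely many elements $m_j^\prime \in M$ and of elements $a_{ij} \in R$ (for each $j$, only finitely many $a_{ij}$ nonzero) such that $$\sum_j a_{ij} m_j^\prime = m_i \text{ for all } i \in I \quad\text{and}\quad \sum_i a_{ij} n_i = 0 \text{ for all } j.$$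
   Context: An $R$-module $T$ with an $R$-bilinear map $\phi : M \times N \rightarrow T$ is a tensor product of two $R$-modules $M$, $N$ if for all $R$-bilinear maps $\psi : M \times N \rightarrow S$ to an $R$-module $S$ there is a unique $R$-module homomorphism $f : T \rightarrow S$ such that $\psi = f \circ \phi$. *)

theory Defs
  imports "HOL.Hull" "HOL-Algebra.Module" "HOL-Algebra.Free_Abelian_Groups"
begin

definition module_homs ::
    "('r, 'a) ring_scheme \<Rightarrow> ('r, 'x, 'b) module_scheme \<Rightarrow> ('r, 'y, 'c) module_scheme \<Rightarrow> ('x \<Rightarrow> 'y) set"
  where "module_homs R X Y =
    {f \<in> hom (add_monoid X) (add_monoid Y).
       \<forall>a \<in> carrier R. \<forall>x \<in> carrier X. f (a \<odot>\<^bsub>X\<^esub> x) = a \<odot>\<^bsub>Y\<^esub> f x}"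

definition bilinear_map ::
    "('r, 'a) ring_scheme \<Rightarrow> ('r, 'm, 'b) module_scheme \<Rightarrow> ('r, 'n, 'c) module_scheme \<Rightarrow>
     ('r, 't, 'd) module_scheme \<Rightarrow> ('m \<times> 'n \<Rightarrow> 't) \<Rightarrow> bool"
  where "bilinear_map R M N T \<phi> \<longleftrightarrow>
    (\<forall>x \<in> carrier M. (\<lambda>y. \<phi> (x, y)) \<in> module_homs R N T) \<and>
    (\<forall>y \<in> carrier N. (\<lambda>x. \<phi> (x, y)) \<in> module_homs R M T)"

text \<open>
  HOL cannot quantify over types inside a formula, so the type of the elements of the test
  modules \<open>S\<close> is a parameter, passed as \<open>TYPE('s)\<close>. A statement that leaves \<open>'s\<close> a free type
  variable, unconstrained by its hypotheses, is about test modules over every type.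
  Maps out of \<open>T\<close> are made \<^const>\<open>extensional\<close> because values outside \<^term>\<open>carrier T\<close> are
  irrelevant and would otherwise spoil uniqueness.
\<close>
definition is_tensor_product ::
    "'s itself \<Rightarrow> ('r, 'a) ring_scheme \<Rightarrow> ('r, 'm, 'b) module_scheme \<Rightarrow>
     ('r, 'n, 'c) module_scheme \<Rightarrow> ('r, 't, 'd) module_scheme \<Rightarrow> ('m \<times> 'n \<Rightarrow> 't) \<Rightarrow> bool"
  where "is_tensor_product _ R M N T \<phi> \<longleftrightarrow>
    module R T \<and> bilinear_map R M N T \<phi> \<and>
    (\<forall>(S :: ('r, 's) module) \<psi>. module R S \<and> bilinear_map R M N S \<psi> \<longrightarrow>
       (\<exists>!f. f \<in> module_homs R T S \<inter> extensional (carrier T) \<and>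
             (\<forall>p \<in> carrier M \<times> carrier N. \<psi> p = (f \<circ> \<phi>) p)))"

definition generates_module ::
    "('r, 'a) ring_scheme \<Rightarrow> ('r, 'n, 'c) module_scheme \<Rightarrow> 'i set \<Rightarrow> ('i \<Rightarrow> 'n) \<Rightarrow> bool"
  where "generates_module R N I n \<longleftrightarrow>
    n \<in> I \<rightarrow> carrier N \<and> (\<lambda>H. submodule H R N) hull (n ` I) = carrier N"

definition finsupp_families :: "'i set \<Rightarrow> ('x, 'b) ring_scheme \<Rightarrow> ('i \<Rightarrow> 'x) set"
  where "finsupp_families I X = {m \<in> I \<rightarrow> carrier X. finite {i \<in> I. m i \<noteq> \<zero>\<^bsub>X\<^esub>}}"

text \<open>
  The sum over a possibly infinite index set of a family with only finitely many nonzero terms.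
  On other families its value is the junk value zero; \<^const>\<open>finsum\<close> itself returns zero on every
  infinite index set.
\<close>
definition gfinsum :: "('x, 'b) ring_scheme \<Rightarrow> ('i \<Rightarrow> 'x) \<Rightarrow> 'i set \<Rightarrow> 'x"
  where "gfinsum X = gfinprod (add_monoid X)"

end

theory Submission
  imports Defs
begin

text \<open>
  A bilinear map \<open>\<psi>\<close> is forced to factor through the assignment sending a sum of the
  \<open>\<phi> (m\<^sub>i, n\<^sub>i)\<close> to the corresponding sum of the \<open>\<psi> (m\<^sub>i, n\<^sub>i)\<close>. The relations in (2) are exactly
  what makes this well defined: if \<open>m\<^sub>i\<close> is the sum of the \<open>a\<^sub>i\<^sub>j m'\<^sub>j\<close>, then interchanging the two sums
  gives \<open>\<Sum>\<^sub>i \<psi> (m\<^sub>i, n\<^sub>i) = \<Sum>\<^sub>j \<psi> (m'\<^sub>j, \<Sum>\<^sub>i a\<^sub>i\<^sub>j n\<^sub>i) = 0\<close>.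
\<close>

section \<open>Finite products: interchange and homomorphisms\<close>

lemma (in comm_monoid) finprod_swap:
  assumes "finite A" "finite B" "\<And>i j. i \<in> A \<Longrightarrow> j \<in> B \<Longrightarrow> f i j \<in> carrier G"
  shows "(\<Otimes>i\<in>A. \<Otimes>j\<in>B. f i j) = (\<Otimes>j\<in>B. \<Otimes>i\<in>A. f i j)"
  using assms(1,3)
proof (induction A)
  case empty
  then show ?case by (simp add: finprod_one)
next
  case (insert x F)
  then have "(\<Otimes>j\<in>B. \<Otimes>i\<in>insert x F. f i j) = (\<Otimes>j\<in>B. f x j \<otimes> (\<Otimes>i\<in>F. f i j))"
    by (intro finprod_cong') (auto intro!: finprod_closed finprod_insert)
  also have "\<dots> = (\<Otimes>j\<in>B. f x j) \<otimes> (\<Otimes>j\<in>B. \<Otimes>i\<in>F. f i j)"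
    using insert by (intro finprod_multf) (auto intro!: finprod_closed)
  finally show ?case
    using insert by (subst finprod_insert) (auto intro!: finprod_closed)
qed

text \<open>An infinite \<open>A\<close> is allowed: both products are then the default value one,
  which a group homomorphism preserves.\<close>

lemma hom_finprod:
  assumes "comm_group G" "comm_group H" "h \<in> hom G H" "f \<in> A \<rightarrow> carrier G"
  shows "h (finprod G f A) = finprod H (\<lambda>i. h (f i)) A"
proof -
  interpret G: comm_group G by fact
  interpret H: comm_group H by fact
  interpret group_hom G H h
    by (simp add: G.is_group H.is_group assms(3) group_hom.intro group_hom_axioms.intro)
  show ?thesis
    using assms(4)
  proof (induction A rule: infinite_finite_induct)
    case (insert x F)
    then have "f x \<in> carrier G" "f \<in> F \<rightarrow> carrier G" by auto
    with insert show ?case by (simp add: Pi_iff)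
  qed auto
qed

section \<open>Sums of finitely supported families\<close>

text \<open>\<open>F\<close> only has to contain the support, so a single \<open>F\<close> can serve
  several families at once.\<close>

lemma gfinsum_eq_finsum:
  assumes "abelian_monoid X" "finite F" "F \<subseteq> I" "f \<in> I \<rightarrow> carrier X"
    and "\<And>i. i \<in> I - F \<Longrightarrow> f i = \<zero>\<^bsub>X\<^esub>"
  shows "gfinsum X f I = finsum X f F"
proof -
  interpret abelian_monoid X by fact
  have "gfinprod (add_monoid X) f I = gfinprod (add_monoid X) f F"
    using assms by (intro add.gfinprod_mono_neutral_cong_right) auto
  also have "\<dots> = finsum X f F"
    using assms by (subst add.gfinprod_eq_finprod) (auto simp: finsum_def)
  finally show ?thesis
    by (simp add: gfinsum_def)
qed

lemma gfinsum_cong: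
  assumes "abelian_monoid X" "\<And>i. i \<in> I \<Longrightarrow> f i = g i" "g \<in> I \<rightarrow> carrier X"
  shows "gfinsum X f I = gfinsum X g I"
proof -
  interpret abelian_monoid X by fact
  show ?thesis
    unfolding gfinsum_def using assms by (intro add.gfinprod_cong) (auto simp: simp_implies_def)
qed

text \<open>If the support is infinite, the sum is the junk value zero, which lies in the carrier as
  well.\<close>

lemma gfinsum_closed:
  assumes "abelian_monoid X" "f \<in> I \<rightarrow> carrier X"
  shows "gfinsum X f I \<in> carrier X"
proof -
  interpret abelian_monoid X by fact
  show ?thesis
    unfolding gfinsum_def using add.gfinprod_closed[of f I] assms by simp
qed

lemma gfinsum_add:
  assumes "abelian_monoid X" "f \<in> finsupp_families I X" "g \<in> finsupp_families I X"
  shows "gfinsum X (\<lambda>i. f i \<oplus>\<^bsub>X\<^esub> g i) I = gfinsum X f I \<oplus>\<^bsub>X\<^esub> gfinsum X g I"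
proof -
  interpret abelian_monoid X by fact
  show ?thesis
    unfolding gfinsum_def using add.gfinprod_distrib[of I f g] assms
    by (simp add: finsupp_families_def)
qed

text \<open>The support of \<open>g\<close> lies in that of \<open>f\<close>. This carries finite
  support through negation, scaling and pairing with fixed elements.\<close>

lemma finsupp_families_subset_support:
  assumes "f \<in> finsupp_families J X" "g \<in> J \<rightarrow> carrier Y"
    and "\<And>i. i \<in> J \<Longrightarrow> f i = \<zero>\<^bsub>X\<^esub> \<Longrightarrow> g i = \<zero>\<^bsub>Y\<^esub>"
  shows "g \<in> finsupp_families J Y"
proof -
  have "{i \<in> J. g i \<noteq> \<zero>\<^bsub>Y\<^esub>} \<subseteq> {i \<in> J. f i \<noteq> \<zero>\<^bsub>X\<^esub>}"
    using assms(3) by auto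
  then show ?thesis
    using assms(1,2) by (auto simp: finsupp_families_def intro: finite_subset)
qed

lemma finsupp_families_add:
  assumes "abelian_monoid X" "f \<in> finsupp_families J X" "g \<in> finsupp_families J X"
  shows "(\<lambda>i. f i \<oplus>\<^bsub>X\<^esub> g i) \<in> finsupp_families J X"
proof -
  interpret abelian_monoid X by fact
  have "{i \<in> J. f i \<oplus>\<^bsub>X\<^esub> g i \<noteq> \<zero>\<^bsub>X\<^esub>} \<subseteq> {i \<in> J. f i \<noteq> \<zero>\<^bsub>X\<^esub>} \<union> {i \<in> J. g i \<noteq> \<zero>\<^bsub>X\<^esub>}"
    by auto
  moreover have "finite \<dots>"
    using assms by (simp add: finsupp_families_def)
  ultimately show ?thesis
    using assms finite_subset by (fastforce simp: finsupp_families_def)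
qed

lemma finsupp_familiesD:
  assumes "f \<in> finsupp_families J X" "i \<in> J"
  shows "f i \<in> carrier X"
  using assms by (auto simp: finsupp_families_def)

section \<open>Module homomorphisms and sums\<close>

lemma module_homsD:
  assumes "f \<in> module_homs R X Y"
  shows "f \<in> hom (add_monoid X) (add_monoid Y)"
    and "x \<in> carrier X \<Longrightarrow> f x \<in> carrier Y"
    and "x \<in> carrier X \<Longrightarrow> y \<in> carrier X \<Longrightarrow> f (x \<oplus>\<^bsub>X\<^esub> y) = f x \<oplus>\<^bsub>Y\<^esub> f y"
    and "a \<in> carrier R \<Longrightarrow> x \<in> carrier X \<Longrightarrow> f (a \<odot>\<^bsub>X\<^esub> x) = a \<odot>\<^bsub>Y\<^esub> f x"
  using assms by (auto simp: module_homs_def hom_def)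

lemma module_homs_zero:
  assumes "module R X" "module R Y" "f \<in> module_homs R X Y"
  shows "f \<zero>\<^bsub>X\<^esub> = \<zero>\<^bsub>Y\<^esub>"
proof -
  interpret X: module R X by fact
  interpret Y: module R Y by fact
  show ?thesis
    using hom_one[OF module_homsD(1)[OF assms(3)]] X.add.is_group Y.add.is_group by simp
qed

lemma module_homs_finsum:
  assumes "module R X" "module R Y" "f \<in> module_homs R X Y" "g \<in> A \<rightarrow> carrier X"
  shows "f (finsum X g A) = finsum Y (\<lambda>i. f (g i)) A"
proof -
  interpret X: module R X by fact
  interpret Y: module R Y by fact
  show ?thesis
    using hom_finprod[OF X.a_comm_group Y.a_comm_group module_homsD(1)[OF assms(3)]] assms(4)
    by (simp add: finsum_def)
qed

text \<open>Since \<open>f\<close> preserves zero, the support of \<open>g\<close> contains that of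
  the image family, so both sums reduce to finite sums over the same set. Finite support of
  \<open>g\<close> matters: \<open>f\<close> could kill all but finitely many terms of a family
  whose own sum is only the junk value zero.\<close>

lemma module_homs_gfinsum:
  assumes "module R X" "module R Y" "f \<in> module_homs R X Y" "g \<in> finsupp_families J X"
  shows "f (gfinsum X g J) = gfinsum Y (\<lambda>i. f (g i)) J"
proof -
  interpret X: module R X by fact
  interpret Y: module R Y by fact
  note [simp] = module_homs_zero[OF assms(1-3)]
  let ?F = "{i \<in> J. g i \<noteq> \<zero>\<^bsub>X\<^esub>}"
  have g: "g \<in> J \<rightarrow> carrier X" "finite ?F"
    using assms(4) by (auto simp: finsupp_families_def)
  have fg: "(\<lambda>i. f (g i)) \<in> J \<rightarrow> carrier Y"
    using g module_homsD(2)[OF assms(3)] by auto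
  have "f (gfinsum X g J) = f (finsum X g ?F)"
    using g by (subst gfinsum_eq_finsum[of X ?F]) (auto intro: X.abelian_monoid_axioms)
  also have "\<dots> = finsum Y (\<lambda>i. f (g i)) ?F"
    using g by (intro module_homs_finsum[OF assms(1-3)]) auto
  also have "\<dots> = gfinsum Y (\<lambda>i. f (g i)) J"
    using g fg by (subst gfinsum_eq_finsum[of Y ?F]) (auto intro: Y.abelian_monoid_axioms)
  finally show ?thesis .
qed

text \<open>Commutativity of \<open>R\<close> makes scaling linear. Scalars can then be moved
  through \<open>gfinsum\<close> as a special case of \<open>module_homs_gfinsum\<close>.\<close>

lemma smult_module_homs:
  assumes "module R X" "a \<in> carrier R"
  shows "(\<lambda>x. a \<odot>\<^bsub>X\<^esub> x) \<in> module_homs R X X"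
proof -
  interpret module R X by fact
  show ?thesis
    using assms(2)
    by (auto simp: module_homs_def hom_def smult_r_distr R.m_comm simp flip: smult_assoc1)
qed

lemma smult_finsupp_families:
  assumes "module R X" "b \<in> finsupp_families J R" "x \<in> J \<rightarrow> carrier X"
  shows "(\<lambda>i. b i \<odot>\<^bsub>X\<^esub> x i) \<in> finsupp_families J X"
proof -
  interpret module R X by fact
  show ?thesis
    using assms by (intro finsupp_families_subset_support[OF assms(2)])
      (auto simp: Pi_iff finsupp_familiesD[OF assms(2)])
qed

section \<open>Linear combinations of generators\<close>

text \<open>The set \<open>H\<close> of all finite linear combinations of the generators is a
  submodule containing them. It therefore contains their hull, which is all of
  \<open>N\<close>.\<close>

lemma generates_module_lincomb:
  assumes N: "module R N" and gen: "generates_module R N I n" and y: "y \<in> carrier N"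
  obtains b where "b \<in> finsupp_families I R" "y = gfinsum N (\<lambda>i. b i \<odot>\<^bsub>N\<^esub> n i) I"
proof -
  interpret N: module R N by fact
  note am = N.abelian_monoid_axioms N.R.abelian_monoid_axioms
  define H where "H = (\<lambda>b. gfinsum N (\<lambda>i. b i \<odot>\<^bsub>N\<^esub> n i) I) ` finsupp_families I R"
  have n: "n \<in> I \<rightarrow> carrier N" "\<And>i. i \<in> I \<Longrightarrow> n i \<in> carrier N"
    using gen by (auto simp: generates_module_def)
  note fam = smult_finsupp_families[OF N _ n(1)]
  have sub: "H \<subseteq> carrier N"
    using fam by (auto simp: H_def finsupp_families_def intro!: gfinsum_closed am)
  have add: "u \<oplus>\<^bsub>N\<^esub> v \<in> H" if "u \<in> H" "v \<in> H" for u v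
  proof -
    from that obtain b c where bc: "b \<in> finsupp_families I R" "c \<in> finsupp_families I R"
      and uv: "u = gfinsum N (\<lambda>i. b i \<odot>\<^bsub>N\<^esub> n i) I" "v = gfinsum N (\<lambda>i. c i \<odot>\<^bsub>N\<^esub> n i) I"
      by (auto simp: H_def)
    have "u \<oplus>\<^bsub>N\<^esub> v = gfinsum N (\<lambda>i. b i \<odot>\<^bsub>N\<^esub> n i \<oplus>\<^bsub>N\<^esub> c i \<odot>\<^bsub>N\<^esub> n i) I"
      unfolding uv by (rule gfinsum_add[symmetric]) (use bc fam am in auto)
    also have "\<dots> = gfinsum N (\<lambda>i. (b i \<oplus>\<^bsub>R\<^esub> c i) \<odot>\<^bsub>N\<^esub> n i) I"
      by (rule gfinsum_cong[OF am(1)])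
        (use n bc[THEN finsupp_familiesD] in \<open>auto simp: N.smult_l_distr\<close>)
    finally show ?thesis
      using finsupp_families_add[OF am(2) bc] by (auto simp: H_def)
  qed
  have smult: "a \<odot>\<^bsub>N\<^esub> u \<in> H" if a: "a \<in> carrier R" and "u \<in> H" for a u
  proof -
    from that obtain b where b: "b \<in> finsupp_families I R"
      and u: "u = gfinsum N (\<lambda>i. b i \<odot>\<^bsub>N\<^esub> n i) I"
      by (auto simp: H_def)
    have "a \<odot>\<^bsub>N\<^esub> u = gfinsum N (\<lambda>i. a \<odot>\<^bsub>N\<^esub> (b i \<odot>\<^bsub>N\<^esub> n i)) I"
      unfolding u by (rule module_homs_gfinsum[OF N N smult_module_homs[OF N a] fam[OF b]])
    also have "\<dots> = gfinsum N (\<lambda>i. (a \<otimes>\<^bsub>R\<^esub> b i) \<odot>\<^bsub>N\<^esub> n i) I"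
      by (rule gfinsum_cong[OF am(1)])
        (use n a finsupp_familiesD[OF b] in \<open>auto simp: N.smult_assoc1\<close>)
    finally show ?thesis
      using a finsupp_families_subset_support[OF b, of "\<lambda>i. a \<otimes>\<^bsub>R\<^esub> b i" R]
      by (auto simp: H_def finsupp_familiesD[OF b])
  qed
  have gens: "n i \<in> H" if i: "i \<in> I" for i
  proof -
    let ?b = "\<lambda>j. if j = i then \<one>\<^bsub>R\<^esub> else \<zero>\<^bsub>R\<^esub>"
    have "?b \<in> finsupp_families I R"
      by (auto simp: finsupp_families_def intro: finite_subset[of _ "{i}"])
    moreover have "gfinsum N (\<lambda>j. ?b j \<odot>\<^bsub>N\<^esub> n j) I = finsum N (\<lambda>j. ?b j \<odot>\<^bsub>N\<^esub> n j) {i}"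
      using i n by (intro gfinsum_eq_finsum am) auto
    ultimately show ?thesis
      using i n by (auto simp: H_def Pi_iff image_iff intro!: bexI[of _ ?b])
  qed
  \<comment> \<open>The zero family shows that \<open>H\<close> is nonempty. Zero and negatives then
    come from closure under scaling, by the scalars 0 and -1.\<close>
  have "(\<lambda>i. \<zero>\<^bsub>R\<^esub>) \<in> finsupp_families I R"
    by (auto simp: finsupp_families_def)
  then obtain z where z: "z \<in> H"
    by (auto simp: H_def)
  have "\<zero>\<^bsub>N\<^esub> \<in> H"
    using smult[OF N.R.zero_closed z] z sub by auto
  moreover have "\<ominus>\<^bsub>N\<^esub> u \<in> H" if "u \<in> H" for u
    using smult[of "\<ominus>\<^bsub>R\<^esub> \<one>\<^bsub>R\<^esub>" u] that sub by (auto simp: N.smult_l_minus subset_iff)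
  ultimately have "submodule H R N"
    using sub add smult by (intro N.submoduleI) auto
  then have "(\<lambda>H. submodule H R N) hull (n ` I) \<subseteq> H"
    using gens by (intro hull_minimal) auto
  then have "y \<in> H"
    using gen y by (auto simp: generates_module_def)
  then show ?thesis
    using that by (auto simp: H_def)
qed

section \<open>Pairing families in M with the generators\<close>

text \<open>The bilinear map is kept arbitrary because two instances are compared later, for
  \<open>\<phi>\<close> into \<open>T\<close> and for \<open>\<psi>\<close> into \<open>S\<close>,
  over the same families of elements of \<open>M\<close>.\<close>

locale paired_family =
  fixes R :: "('r, 'a) ring_scheme"
    and M :: "('r, 'm, 'b) module_scheme"
    and N :: "('r, 'n, 'c) module_scheme"
    and S :: "('r, 's, 'd) module_scheme"
    and \<psi> :: "'m \<times> 'n \<Rightarrow> 's"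
    and I :: "'i set"
    and n :: "'i \<Rightarrow> 'n"
  assumes M: "module R M" and N: "module R N" and S: "module R S"
    and bilin: "bilinear_map R M N S \<psi>"
    and n: "n \<in> I \<rightarrow> carrier N"
begin

sublocale M: module R M by (rule M)
sublocale N: module R N by (rule N)
sublocale S: module R S by (rule S)

text \<open>In the instance for \<open>\<phi>\<close> this is the sum occurring in conditions (1)
  and (2).\<close>

definition pair_sum :: "('i \<Rightarrow> 'm) \<Rightarrow> 's"
  where "pair_sum m = gfinsum S (\<lambda>i. \<psi> (m i, n i)) I"

lemma n_closed: "i \<in> I \<Longrightarrow> n i \<in> carrier N"
  using n by auto

lemma left_hom: "y \<in> carrier N \<Longrightarrow> (\<lambda>x. \<psi> (x, y)) \<in> module_homs R M S"
  using bilin by (auto simp: bilinear_map_def)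

lemma right_hom: "x \<in> carrier M \<Longrightarrow> (\<lambda>y. \<psi> (x, y)) \<in> module_homs R N S"
  using bilin by (auto simp: bilinear_map_def)

lemmas left = module_homsD(2-4)[OF left_hom] module_homs_zero[OF M S left_hom]
lemmas right = module_homsD(2-4)[OF right_hom] module_homs_zero[OF N S right_hom]

lemma finsupp_pairing:
  assumes "m \<in> finsupp_families I M"
  shows "(\<lambda>i. \<psi> (m i, n i)) \<in> finsupp_families I S"
  by (rule finsupp_families_subset_support[OF assms])
    (simp_all add: left(1,4) n_closed finsupp_familiesD[OF assms])

lemma pair_sum_closed:
  assumes "m \<in> finsupp_families I M"
  shows "pair_sum m \<in> carrier S"
  unfolding pair_sum_def
  by (rule gfinsum_closed[OF S.abelian_monoid_axioms])
    (simp add: finsupp_familiesD[OF finsupp_pairing[OF assms]])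

lemma pair_sum_cong:
  assumes "m \<in> finsupp_families I M" "\<And>i. i \<in> I \<Longrightarrow> m' i = m i"
  shows "pair_sum m' = pair_sum m"
  unfolding pair_sum_def
  by (rule gfinsum_cong[OF S.abelian_monoid_axioms])
    (simp_all add: assms(2) finsupp_familiesD[OF finsupp_pairing[OF assms(1)]])

lemma pair_sum_add:
  assumes "m \<in> finsupp_families I M" "m' \<in> finsupp_families I M"
  shows "pair_sum (\<lambda>i. m i \<oplus>\<^bsub>M\<^esub> m' i) = pair_sum m \<oplus>\<^bsub>S\<^esub> pair_sum m'"
proof -
  note fam = finsupp_pairing[OF assms(1)] finsupp_pairing[OF assms(2)]
  have "pair_sum (\<lambda>i. m i \<oplus>\<^bsub>M\<^esub> m' i) = gfinsum S (\<lambda>i. \<psi> (m i, n i) \<oplus>\<^bsub>S\<^esub> \<psi> (m' i, n i)) I"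
    unfolding pair_sum_def
    by (rule gfinsum_cong[OF S.abelian_monoid_axioms])
      (use assms[THEN finsupp_familiesD] in \<open>auto simp: left n_closed\<close>)
  then show ?thesis
    using gfinsum_add[OF S.abelian_monoid_axioms fam] by (simp add: pair_sum_def)
qed

lemma pair_sum_smult:
  assumes "m \<in> finsupp_families I M" "a \<in> carrier R"
  shows "pair_sum (\<lambda>i. a \<odot>\<^bsub>M\<^esub> m i) = a \<odot>\<^bsub>S\<^esub> pair_sum m"
proof -
  have "pair_sum (\<lambda>i. a \<odot>\<^bsub>M\<^esub> m i) = gfinsum S (\<lambda>i. a \<odot>\<^bsub>S\<^esub> \<psi> (m i, n i)) I"
    unfolding pair_sum_def
    by (rule gfinsum_cong[OF S.abelian_monoid_axioms])
      (use assms(2) finsupp_familiesD[OF assms(1)] in \<open>auto simp: left n_closed\<close>)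
  then show ?thesis
    using module_homs_gfinsum[OF S S smult_module_homs[OF S assms(2)] finsupp_pairing[OF assms(1)]]
    by (simp add: pair_sum_def)
qed

text \<open>Bilinearity moves each scalar \<open>b i\<close> from the first argument to the second,
  and additivity in the second argument collects the sum. This annihilates the relations in (2), and
  it also rewrites an arbitrary value of the bilinear map as a pairing with generators.\<close>

lemma pair_sum_smult_const:
  assumes "b \<in> finsupp_families I R" "x \<in> carrier M"
  shows "pair_sum (\<lambda>i. b i \<odot>\<^bsub>M\<^esub> x) = \<psi> (x, gfinsum N (\<lambda>i. b i \<odot>\<^bsub>N\<^esub> n i) I)"
proof -
  have "pair_sum (\<lambda>i. b i \<odot>\<^bsub>M\<^esub> x) = gfinsum S (\<lambda>i. \<psi> (x, b i \<odot>\<^bsub>N\<^esub> n i)) I"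
    unfolding pair_sum_def
    by (rule gfinsum_cong[OF S.abelian_monoid_axioms])
      (simp_all add: left(1,3) right(1,3) n_closed Pi_iff assms(2) finsupp_familiesD[OF assms(1)])
  then show ?thesis
    using module_homs_gfinsum[OF N S right_hom[OF assms(2)] smult_finsupp_families[OF N assms(1) n]]
    by simp
qed

text \<open>Expanding every \<open>m i\<close> yields a double sum. Summing over \<open>i\<close>
  first gives \<open>\<psi>\<close> of \<open>m' j\<close> and a combination of generators that
  vanishes by \<open>rel\<close>. Membership of \<open>m i\<close> in \<open>M\<close> and finite
  support of \<open>m\<close> are derived from the data \<open>a\<close> and
  \<open>m'\<close>.\<close>

lemma pair_sum_relation:
  fixes k :: nat
  assumes m': "\<forall>j<k. m' j \<in> carrier M"
    and a: "\<forall>j<k. (\<lambda>i. a i j) \<in> finsupp_families I R"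
    and m: "\<forall>i\<in>I. (\<Oplus>\<^bsub>M\<^esub>j\<in>{..<k}. a i j \<odot>\<^bsub>M\<^esub> m' j) = m i"
    and rel: "\<forall>j<k. gfinsum N (\<lambda>i. a i j \<odot>\<^bsub>N\<^esub> n i) I = \<zero>\<^bsub>N\<^esub>"
  shows "pair_sum m = \<zero>\<^bsub>S\<^esub>"
proof -
  \<comment> \<open>The union of the supports of the \<open>k\<close> columns of \<open>a\<close> is
    a finite set outside which all \<open>a i j\<close>, and hence all \<open>m i\<close>, vanish.
    Both sums become finite, so they can be interchanged.\<close>
  define F where "F = (\<Union>j<k. {i \<in> I. a i j \<noteq> \<zero>\<^bsub>R\<^esub>})"
  have F: "finite F" "F \<subseteq> I"
    using a by (auto simp: F_def finsupp_families_def)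
  have a_closed: "a i j \<in> carrier R" if "i \<in> I" "j < k" for i j
    using a that by (auto dest: finsupp_familiesD)
  have am_closed: "a i j \<odot>\<^bsub>M\<^esub> m' j \<in> carrier M" if "i \<in> I" "j < k" for i j
    using a_closed m' that by auto
  have m_closed: "m i \<in> carrier M" if "i \<in> I" for i
    using m that am_closed by (auto intro!: M.finsum_closed simp flip: m)
  have \<psi>_closed: "\<psi> (a i j \<odot>\<^bsub>M\<^esub> m' j, n i) \<in> carrier S" if "i \<in> I" "j < k" for i j
    using that am_closed by (auto simp: left n_closed)
  have m_zero: "m i = \<zero>\<^bsub>M\<^esub>" if "i \<in> I - F" for i
  proof -
    have "m i = (\<Oplus>\<^bsub>M\<^esub>j\<in>{..<k}. a i j \<odot>\<^bsub>M\<^esub> m' j)"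
      using m that by simp
    also have "\<dots> = (\<Oplus>\<^bsub>M\<^esub>j\<in>{..<k}. \<zero>\<^bsub>M\<^esub>)"
      using that m' by (intro M.finsum_cong') (auto simp: F_def)
    finally show ?thesis by simp
  qed
  have "pair_sum m = (\<Oplus>\<^bsub>S\<^esub>i\<in>F. \<psi> (m i, n i))"
    unfolding pair_sum_def using F m_closed m_zero
    by (intro gfinsum_eq_finsum S.abelian_monoid_axioms) (auto simp: left n_closed)
  also have "\<dots> = (\<Oplus>\<^bsub>S\<^esub>i\<in>F. \<Oplus>\<^bsub>S\<^esub>j\<in>{..<k}. \<psi> (a i j \<odot>\<^bsub>M\<^esub> m' j, n i))"
  proof (intro S.finsum_cong')
    fix i assume "i \<in> F"
    then have i: "i \<in> I" using F by auto
    have "\<psi> (m i, n i) = \<psi> (\<Oplus>\<^bsub>M\<^esub>j\<in>{..<k}. a i j \<odot>\<^bsub>M\<^esub> m' j, n i)"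
      using m i by simp
    also have "\<dots> = (\<Oplus>\<^bsub>S\<^esub>j\<in>{..<k}. \<psi> (a i j \<odot>\<^bsub>M\<^esub> m' j, n i))"
      by (rule module_homs_finsum[OF M S left_hom[OF n_closed[OF i]]])
        (use i am_closed in auto)
    finally show "\<psi> (m i, n i) = (\<Oplus>\<^bsub>S\<^esub>j\<in>{..<k}. \<psi> (a i j \<odot>\<^bsub>M\<^esub> m' j, n i))" .
  qed (use F \<psi>_closed in \<open>auto intro!: S.finsum_closed\<close>)
  also have "\<dots> = (\<Oplus>\<^bsub>S\<^esub>j\<in>{..<k}. \<Oplus>\<^bsub>S\<^esub>i\<in>F. \<psi> (a i j \<odot>\<^bsub>M\<^esub> m' j, n i))"
    using F \<psi>_closed by (intro S.add.finprod_swap) auto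
  also have "\<dots> = (\<Oplus>\<^bsub>S\<^esub>j\<in>{..<k}. \<zero>\<^bsub>S\<^esub>)"
  proof (intro S.finsum_cong')
    fix j assume "j \<in> {..<k}"
    then have j: "j < k" by simp
    \<comment> \<open>As \<open>F\<close> contains the support of column \<open>j\<close>, the sum
      may be extended back to all of \<open>I\<close>, where \<open>pair_sum_smult_const\<close>
      applies.\<close>
    have "(\<Oplus>\<^bsub>S\<^esub>i\<in>F. \<psi> (a i j \<odot>\<^bsub>M\<^esub> m' j, n i)) = pair_sum (\<lambda>i. a i j \<odot>\<^bsub>M\<^esub> m' j)"
      unfolding pair_sum_def using F j \<psi>_closed m'
      by (intro gfinsum_eq_finsum[symmetric] S.abelian_monoid_axioms)
        (auto simp: F_def left n_closed)
    also have "\<dots> = \<zero>\<^bsub>S\<^esub>"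
      using pair_sum_smult_const[of "\<lambda>i. a i j" "m' j"] a m' rel j by (simp add: right)
    finally show "(\<Oplus>\<^bsub>S\<^esub>i\<in>F. \<psi> (a i j \<odot>\<^bsub>M\<^esub> m' j, n i)) = \<zero>\<^bsub>S\<^esub>" .
  qed auto
  finally show ?thesis by simp
qed

end

section \<open>The universal property\<close>

theorem proposition3p67:
  fixes R :: "('r, 'a) ring_scheme"
    and M :: "('r, 'm, 'b) module_scheme"
    and N :: "('r, 'n, 'c) module_scheme"
    and T :: "('r, 't, 'd) module_scheme"
    and \<phi> :: "'m \<times> 'n \<Rightarrow> 't"
    and I :: "'i set"
    and n :: "'i \<Rightarrow> 'n"
  assumes "cring R"
    and "module R M" and "module R N" and "module R T"
    and "bilinear_map R M N T \<phi>"
    and "generates_module R N I n"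
    and "\<forall>t \<in> carrier T. \<exists>m \<in> finsupp_families I M. t = gfinsum T (\<lambda>i. \<phi> (m i, n i)) I"
    and "\<forall>m \<in> finsupp_families I M. gfinsum T (\<lambda>i. \<phi> (m i, n i)) I = \<zero>\<^bsub>T\<^esub> \<longrightarrow>
           (\<exists>(k :: nat) m' a.
              (\<forall>j<k. m' j \<in> carrier M) \<and>
              (\<forall>j<k. (\<lambda>i. a i j) \<in> finsupp_families I R) \<and>
              (\<forall>i \<in> I. (\<Oplus>\<^bsub>M\<^esub>j \<in> {..<k}. a i j \<odot>\<^bsub>M\<^esub> m' j) = m i) \<and>
              (\<forall>j<k. gfinsum N (\<lambda>i. a i j \<odot>\<^bsub>N\<^esub> n i) I = \<zero>\<^bsub>N\<^esub>))"
  shows "is_tensor_product TYPE('s) R M N T \<phi>"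
  unfolding is_tensor_product_def
proof (intro conjI allI impI assms(4) assms(5), elim conjE)
  fix S :: "('r, 's) module" and \<psi> :: "'m \<times> 'n \<Rightarrow> 's"
  assume S: "module R S" and \<psi>: "bilinear_map R M N S \<psi>"
  have n: "n \<in> I \<rightarrow> carrier N"
    using assms(6) by (simp add: generates_module_def)
  interpret T: paired_family R M N T \<phi> I n
    by (rule paired_family.intro) (use assms n in auto)
  interpret S: paired_family R M N S \<psi> I n
    by (rule paired_family.intro) (use assms n S \<psi> in auto)
  let ?fam = "finsupp_families I M"
  have am: "abelian_monoid M"
    by (rule T.M.abelian_monoid_axioms)
  have surj: "\<exists>m\<in>?fam. t = T.pair_sum m" if "t \<in> carrier T" for t
    using assms(7) that by (simp add: T.pair_sum_def)
  \<comment> \<open>Condition (2) turns the vanishing for \<open>\<phi>\<close> into data in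
    \<open>M\<close>, \<open>N\<close> and \<open>R\<close> alone, which mention neither map.
    \<open>pair_sum_relation\<close> can therefore be applied to the same data with
    \<open>\<psi>\<close>.\<close>
  have ker: "S.pair_sum m = \<zero>\<^bsub>S\<^esub>" if "m \<in> ?fam" "T.pair_sum m = \<zero>\<^bsub>T\<^esub>" for m
    using assms(8) that S.pair_sum_relation[of _ _ _ m] unfolding T.pair_sum_def by blast
  have well_def: "S.pair_sum m = S.pair_sum m'"
    if m: "m \<in> ?fam" and m': "m' \<in> ?fam" and eq: "T.pair_sum m = T.pair_sum m'" for m m'
  proof -
    \<comment> \<open>The kernel inclusion is applied to the difference of the two families. Writing
      \<open>m\<close> as \<open>d\<close> plus \<open>m'\<close> lets additivity of
      \<open>pair_sum\<close> suffice, without a rule for negatives.\<close>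
    define d where "d = (\<lambda>i. m i \<oplus>\<^bsub>M\<^esub> \<ominus>\<^bsub>M\<^esub> m' i)"
    have "(\<lambda>i. \<ominus>\<^bsub>M\<^esub> m' i) \<in> ?fam"
      by (intro finsupp_families_subset_support[OF m']) (auto simp: finsupp_familiesD[OF m'])
    then have d: "d \<in> ?fam"
      unfolding d_def using m by (intro finsupp_families_add am)
    have m_eq: "d i \<oplus>\<^bsub>M\<^esub> m' i = m i" if "i \<in> I" for i
      using finsupp_familiesD[OF m that] finsupp_familiesD[OF m' that]
      by (simp add: d_def T.M.a_assoc T.M.l_neg)
    have "T.pair_sum d \<oplus>\<^bsub>T\<^esub> T.pair_sum m' = T.pair_sum m'"
      using T.pair_sum_cong[OF m m_eq] by (simp add: T.pair_sum_add[OF d m'] eq)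
    then have "T.pair_sum d = \<zero>\<^bsub>T\<^esub>"
      using T.pair_sum_closed d m' by simp
    then show ?thesis
      using S.pair_sum_cong[OF m m_eq] ker[OF d] S.pair_sum_closed[OF m']
      by (simp add: S.pair_sum_add[OF d m'])
  qed
  \<comment> \<open>A representing family exists by \<open>surj\<close>, and by
    \<open>well_def\<close> its choice does not affect the value. Restricting to the carrier makes
    \<open>f\<close> extensional; apart from that, only \<open>f_pair\<close> is used about
    \<open>f\<close> from there on.\<close>
  define f where "f = (\<lambda>t\<in>carrier T. S.pair_sum (SOME m. m \<in> ?fam \<and> t = T.pair_sum m))"
  have f_pair: "f (T.pair_sum m) = S.pair_sum m" if m: "m \<in> ?fam" for m
  proof -
    have "\<exists>m'. m' \<in> ?fam \<and> T.pair_sum m = T.pair_sum m'"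
      using m by blast
    from someI_ex[OF this] show ?thesis
      using T.pair_sum_closed[OF m] well_def[OF _ m] by (simp add: f_def)
  qed
  \<comment> \<open>Elements of \<open>T\<close> are lifted to families, on which both instances of
    \<open>pair_sum\<close> are linear.\<close>
  have f_hom: "f \<in> module_homs R T S"
    unfolding module_homs_def
  proof (intro CollectI conjI ballI homI)
    fix t u assume "t \<in> carrier (add_monoid T)" "u \<in> carrier (add_monoid T)"
    then obtain m m' where m: "m \<in> ?fam" "m' \<in> ?fam" "t = T.pair_sum m" "u = T.pair_sum m'"
      using surj[of t] surj[of u] by auto
    then show "f (t \<otimes>\<^bsub>add_monoid T\<^esub> u) = f t \<otimes>\<^bsub>add_monoid S\<^esub> f u"
      using f_pair[OF finsupp_families_add[OF am m(1,2)]]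
      by (simp add: f_pair T.pair_sum_add S.pair_sum_add)
  next
    fix t assume "t \<in> carrier (add_monoid T)"
    then show "f t \<in> carrier (add_monoid S)"
      using surj[of t] by (auto simp: f_pair S.pair_sum_closed)
  next
    fix a t assume a: "a \<in> carrier R" and "t \<in> carrier T"
    then obtain m where m: "m \<in> ?fam" "t = T.pair_sum m"
      using surj by blast
    have "(\<lambda>i. a \<odot>\<^bsub>M\<^esub> m i) \<in> ?fam"
      using a by (intro finsupp_families_subset_support[OF m(1)])
        (auto simp: finsupp_familiesD[OF m(1)])
    from f_pair[OF this] show "f (a \<odot>\<^bsub>T\<^esub> t) = a \<odot>\<^bsub>S\<^esub> f t"
      using m a by (simp add: f_pair T.pair_sum_smult S.pair_sum_smult)
  qed
  have f_\<phi>: "\<psi> p = (f \<circ> \<phi>) p" if "p \<in> carrier M \<times> carrier N" for p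
  proof -
    from that obtain x y where p: "p = (x, y)" "x \<in> carrier M" "y \<in> carrier N"
      by blast
    \<comment> \<open>Expanding \<open>y\<close> in the generators exhibits both
      \<open>\<phi> (x, y)\<close> and \<open>\<psi> (x, y)\<close> as the \<open>pair_sum\<close>
      of one family, with entries \<open>b i\<close> times \<open>x\<close>; on such sums
      \<open>f\<close> is known.\<close>
    obtain b where b: "b \<in> finsupp_families I R" "y = gfinsum N (\<lambda>i. b i \<odot>\<^bsub>N\<^esub> n i) I"
      using generates_module_lincomb[OF assms(3,6) p(3)] .
    have "(\<lambda>i. b i \<odot>\<^bsub>M\<^esub> x) \<in> ?fam"
      using p by (intro smult_finsupp_families[OF assms(2) b(1)]) auto
    from f_pair[OF this] show ?thesis
      using p b by (simp add: T.pair_sum_smult_const S.pair_sum_smult_const)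
  qed
  show "\<exists>!f. f \<in> module_homs R T S \<inter> extensional (carrier T) \<and>
      (\<forall>p\<in>carrier M \<times> carrier N. \<psi> p = (f \<circ> \<phi>) p)"
  proof (rule ex1I[of _ f], intro conjI ballI)
    show "f \<in> module_homs R T S \<inter> extensional (carrier T)"
      using f_hom by (simp add: f_def)
    show "\<psi> p = (f \<circ> \<phi>) p" if "p \<in> carrier M \<times> carrier N" for p
      using f_\<phi> that .
  next
    fix g assume g: "g \<in> module_homs R T S \<inter> extensional (carrier T) \<and>
      (\<forall>p\<in>carrier M \<times> carrier N. \<psi> p = (g \<circ> \<phi>) p)"
    show "g = f"
    proof (rule extensionalityI[of _ "carrier T"])
      fix t assume "t \<in> carrier T"
      then obtain m where m: "m \<in> ?fam" "t = T.pair_sum m"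
        using surj by blast
      \<comment> \<open>Uniqueness: by (1) every \<open>t\<close> is a finite sum of values of
        \<open>\<phi>\<close>, on which \<open>g\<close> must agree with \<open>\<psi>\<close>, so
        linearity fixes \<open>g t\<close>.\<close>
      have "g t = gfinsum S (\<lambda>i. g (\<phi> (m i, n i))) I"
        using module_homs_gfinsum[OF assms(4) S _ T.finsupp_pairing[OF m(1)]] g
        by (simp add: m(2) T.pair_sum_def)
      also have "\<dots> = S.pair_sum m"
        unfolding S.pair_sum_def
        by (rule gfinsum_cong[OF S.S.abelian_monoid_axioms])
          (use g n finsupp_familiesD[OF m(1)] in \<open>auto simp: S.left S.n_closed\<close>)
      finally show "g t = f t"
        by (simp add: m f_pair)
    qed (use g in \<open>auto simp: f_def\<close>)
  qed
qed

end
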